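(* Let $X$ be a Banach space and let $\{S(n)\}_{n\in\mathbb{Z}_{\ge 0}}$ be a discrete semigroup of maps $S(n):X\to X$. Assume the following. (1) For every $n\in\mathbb{Z}_{\ge 0}$ the map $S(n):X\to X$ is continuous, and there is a bounded set $\mathcal{B}\subset X$ such that for every bounded set $D\subset X$ there exists $T_D>0$ with $S(n)D\subset\mathcal{B}$ for all integers $n\ge T_D$. (2) $S(n)\mathcal{B}\subseteq\mathcal{B}$ for all $n\in\mathbb{Z}_{\ge 0}$. (3) There are a linear projection $P:X\to PX$ with finite-dimensional range, $\Lambda:=\dim (PX)$, positive constants $M_1,M_2,M_3$ and real constants $\lambda_0,\lambda_1$ such that for all $n\in\mathbb{Z}_{\ge 0}$ and all $\varphi,\psi\in\mathcal{B}$ $$\|PS(n)\varphi-PS(n)\psi\|\le M_1e^{\lambda_0 n}\|\varphi-\psi\|,$$ $$\|(I-P)S(n)\varphi-(I-P)S(n)\psi\|\le \left(M_2e^{\lambda_1 n}+M_3e^{\lambda_0 n}\right)\|\varphi-\psi\|.$$ Assume moreover that there exists $\alpha>0$ such that $$\zeta:=\alpha e^{\lambda_0}+M_2e^{\lambda_1}+M_3e^{\lambda_0}<1.$$ Then there exists an exponential attractor $\mathcal{M}$ for the semigroup $\{S(n)\}$, and its fractal dimension is bounded by $$\dim_f\mathcal{M}\le\frac{\Lambda\left[\ln\Lambda+\ln\left(2+\frac{M_1}{\alpha}\right)\right]}{-\ln\zeta}<\infty.$$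
   Context: A discrete semigroup on $X$ is a family of maps $S(n):X\to X$, $n\in\mathbb{Z}_{\ge0}$, with $S(0)=\mathrm{Id}_X$ and $S(n+m)=S(n)S(m)$ for all $n,m\in\mathbb{Z}_{\ge0}$. A non-empty compact set $\mathcal{M}\subset X$ is an exponential attractor of $\{S(n)\}$ if: (i) $S(n)\mathcal{M}\subset\mathcal{M}$ for all $n\in\mathbb{Z}_{\ge0}$; (ii) its fractal dimension $\dim_f(\mathcal{M})$ is finite, where $$\dim_f(\mathcal{M})=\limsup_{\varepsilon\to0}\frac{\ln N^X_\varepsilon(\mathcal{M})}{\ln(1/\varepsilon)}$$ and $N^X_\varepsilon(\mathcal{M})$ is the minimal number of $\varepsilon$-balls in $X$ with centres in $X$ needed to cover $\mathcal{M}$; (iii) there is a constant $\omega>0$ such that for every bounded $D\subset X$, $\lim_{n\to\infty}e^{\omega n}\,\mathrm{dist}_X(S(n)D,\mathcal{M})=0$, where $\mathrm{dist}_X(A,B)=\sup_{a\in A}\inf_{b\in B}\|a-b\|$ is the Hausdorff semi-distance. *)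

theory Defs
  imports "HOL-Analysis.Analysis"
begin

definition discrete_semigroup :: "(nat \<Rightarrow> 'a \<Rightarrow> 'a) \<Rightarrow> bool" where
  "discrete_semigroup S \<longleftrightarrow> S 0 = id \<and> (\<forall>n m. S (n + m) = S n \<circ> S m)"

(* Balls are open and centred anywhere in the space, not only in A.  The value is
   infinity exactly when no finite family of eps-balls covers A. *)
definition covering_number :: "real \<Rightarrow> 'a::metric_space set \<Rightarrow> enat" where
  "covering_number \<epsilon> A =
     Inf {enat (card C) | C. finite C \<and> A \<subseteq> (\<Union>c\<in>C. ball c \<epsilon>)}"

(* Intended for non-empty A, so that the covering number is at least 1 and its
   logarithm is a genuine one. *)
definition fractal_dim :: "'a::metric_space set \<Rightarrow> ereal" where
  "fractal_dim A =
     Limsup (at_right 0) (\<lambda>\<epsilon>.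
       (case covering_number \<epsilon> A of
          enat N \<Rightarrow> ereal (ln (real N))
        | \<infinity> \<Rightarrow> \<infinity>) / ereal (ln (1 / \<epsilon>)))"

(* The values lie in ennreal so that the supremum and the infimum are genuine: the
   supremum is 0 for empty A, and it is infinity if the distances are unbounded. *)
definition hausdorff_semidist :: "'a::real_normed_vector set \<Rightarrow> 'a set \<Rightarrow> ennreal" where
  "hausdorff_semidist A B = (SUP a\<in>A. INF b\<in>B. ennreal (norm (a - b)))"

definition exponential_attractor ::
    "(nat \<Rightarrow> 'a \<Rightarrow> 'a) \<Rightarrow> 'a::real_normed_vector set \<Rightarrow> bool" where
  "exponential_attractor S M \<longleftrightarrow>
     M \<noteq> {} \<and> compact M \<and>
     (\<forall>n. S n ` M \<subseteq> M) \<and>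
     \<bar>fractal_dim M\<bar> \<noteq> \<infinity> \<and>
     (\<exists>\<omega>>0. \<forall>D. bounded D \<longrightarrow>
        (\<lambda>n. ennreal (exp (\<omega> * real n)) * hausdorff_semidist (S n ` D) M)
          \<longlonglongrightarrow> 0)"

end

theory Submission
  imports Defs "HOL-Real_Asymp.Real_Asymp" "Jordan_Normal_Form.Determinant"
begin

text \<open>
  Write \<open>f = S 1\<close>, so that \<open>S n = f ^^ n\<close>, and let \<open>d\<close> bound the diameter of \<open>B\<close>. The proof
  covers \<open>f ^^ k ` B\<close> by at most \<open>N ^ k\<close> sets of diameter at most \<open>\<zeta> ^ k * d\<close>, where
  \<open>N = q ^ \<Lambda>\<close> and \<open>q\<close> is the least natural number strictly above \<open>\<Lambda> * M\<^sub>1 / \<alpha>\<close>.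

  For one step, let \<open>U \<subseteq> B\<close> have diameter at most \<open>d\<close>. The set \<open>P (f U)\<close> has diameter at most
  \<open>M\<^sub>1 * exp lam\<^sub>0 * d\<close> in a space of dimension \<open>\<Lambda>\<close>, and a grid cuts it into \<open>N\<close> pieces of diameter
  \<open>\<alpha> * exp lam\<^sub>0 * d\<close> (lemma \<open>finite_dim_partition\<close>). Over each piece the complementary part
  varies by at most \<open>(M\<^sub>2 * exp lam\<^sub>1 + M\<^sub>3 * exp lam\<^sub>0) * d\<close>, and the sum of the two bounds is \<open>\<zeta> * d\<close>
  (lemma \<open>covered_by_small_sets_image\<close>). Bounding diameters rather than radii avoids moving centres
  back into \<open>B\<close>, where alone the estimates hold; such a move would cost a factor 2 that the stated
  dimension bound cannot absorb when \<open>\<Lambda> = 1\<close>.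

  The grid lives in coordinates with respect to a basis of vectors of norm at most 1, whose coordinate
  functionals have norm at most \<open>1 + \<eta>\<close> (lemma \<open>near_auerbach_basis\<close>). As in the classical proof of Auerbach's
  lemma, such a basis spans a parallelepiped of nearly maximal volume, and the volume is the
  absolute value of a determinant. Since \<open>q\<close> is strictly larger than \<open>\<Lambda> * M\<^sub>1 / \<alpha>\<close>, a small \<open>\<eta> > 0\<close>
  is harmless, and a supremum may replace an attained maximum.

  The attractor \<open>M\<close> is the closure of the forward orbits of finite nets \<open>W k \<subseteq> f ^^ k ` B\<close>
  (lemma \<open>dynamical_attractor_from_coverings\<close>). It contains every net, hence attracts at the rate
  \<open>\<zeta> ^ k\<close>. All orbit points that appear from level \<open>k\<close> on lie in \<open>f ^^ k ` B\<close>, which \<open>W k\<close>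
  approximates, and the earlier ones number at most \<open>(k\<^sup>2 + k) * N ^ k\<close>. So a number of balls of the
  order \<open>k\<^sup>2 * N ^ k\<close> and of radius \<open>2 * \<zeta> ^ k * d\<close> covers \<open>M\<close>; the polynomial factor disappears in the
  logarithmic limit, and the dimension is at most \<open>ln N / (- ln \<zeta>)\<close>.
\<close>

section \<open>Finite-dimensional subspaces\<close>

text \<open>
  Induction on \<open>n\<close>: the last vector has positive distance from the span of the others, because
  approximating combinations would have Cauchy coordinates by the induction hypothesis, so that the
  vector would be a combination itself. This distance bounds the last coordinate,
  and subtracting the last term reduces the other coordinates to the induction hypothesis.
\<close>

lemma coordinates_bounded:
  fixes b :: "nat \<Rightarrow> 'a::real_normed_vector"
  assumes "\<And>c. (\<Sum>i<n. c i *\<^sub>R b i) = 0 \<Longrightarrow> \<forall>i<n. c i = 0"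
  shows "\<exists>K. \<forall>c. \<forall>i<n. \<bar>c i\<bar> \<le> K * norm (\<Sum>i<n. c i *\<^sub>R b i)"
  using assms
proof (induction n)
  case 0
  then show ?case by simp
next
  case (Suc n)
  have "\<forall>i<n. c i = 0" if "(\<Sum>i<n. c i *\<^sub>R b i) = 0" for c
  proof -
    have "(\<Sum>i<Suc n. (c(n := 0)) i *\<^sub>R b i) = 0" using that by simp
    from Suc.prems[OF this] show ?thesis by (metis fun_upd_other less_Suc_eq less_irrefl_nat)
  qed
  from Suc.IH[OF this] obtain K' where
    K': "\<And>c i. i < n \<Longrightarrow> \<bar>c i\<bar> \<le> K' * norm (\<Sum>i<n. c i *\<^sub>R b i)" by blast
  define K where "K = \<bar>K'\<bar>"
  have K: "\<bar>c i\<bar> \<le> K * norm (\<Sum>i<n. c i *\<^sub>R b i)" if "i < n" for c i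
    using K'[OF that, of c] mult_right_mono[OF abs_ge_self[of K'] norm_ge_zero, of "\<Sum>i<n. c i *\<^sub>R b i"]
    unfolding K_def by linarith
  have "K \<ge> 0" by (simp add: K_def)
  have "\<exists>d>0. \<forall>c. d \<le> norm (b n - (\<Sum>i<n. c i *\<^sub>R b i))"
  proof (rule ccontr)
    assume "\<not> ?thesis"
    then have "\<exists>c. norm (b n - (\<Sum>i<n. c i *\<^sub>R b i)) < 1 / Suc k" for k
      by (metis not_le of_nat_0_less_iff zero_less_Suc zero_less_divide_1_iff)
    then obtain c where c: "\<And>k. norm (b n - (\<Sum>i<n. c k i *\<^sub>R b i)) < 1 / Suc k" by metis
    define s where "s k = (\<Sum>i<n. c k i *\<^sub>R b i)" for k
    have "(\<lambda>k. b n - s k) \<longlonglongrightarrow> 0"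
      by (rule Lim_null_comparison[OF _ LIMSEQ_inverse_real_of_nat])
        (use c in \<open>auto simp: s_def inverse_eq_divide intro!: always_eventually less_imp_le\<close>)
    from tendsto_diff[OF tendsto_const[of "b n"] this] have s: "s \<longlonglongrightarrow> b n" by simp
    have "convergent (\<lambda>k. c k i)" if "i < n" for i
      unfolding Cauchy_convergent_iff[symmetric]
    proof (rule metric_CauchyI)
      fix e :: real assume "e > 0"
      then have "e / (K + 1) > 0" using \<open>K \<ge> 0\<close> by simp
      from metric_CauchyD[OF LIMSEQ_imp_Cauchy[OF s] this]
      obtain M where M: "\<forall>k\<ge>M. \<forall>l\<ge>M. dist (s k) (s l) < e / (K + 1)" ..
      have "dist (c k i) (c l i) < e" if kl: "k \<ge> M" "l \<ge> M" for k l
      proof -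
        have "\<bar>c k i - c l i\<bar> \<le> K * norm (s k - s l)"
          using K[OF \<open>i < n\<close>, of "\<lambda>i. c k i - c l i"]
          by (simp add: s_def scaleR_diff_left sum_subtractf)
        also have "\<dots> \<le> (K + 1) * norm (s k - s l)" by (simp add: algebra_simps)
        also have "\<dots> < e" using M kl \<open>K \<ge> 0\<close> by (simp add: dist_norm field_simps)
        finally show ?thesis by (simp add: dist_real_def)
      qed
      then show "\<exists>M. \<forall>m\<ge>M. \<forall>n\<ge>M. dist (c m i) (c n i) < e" by blast
    qed
    then have "\<exists>a. (\<lambda>k. c k i) \<longlonglongrightarrow> a" if "i < n" for i
      using that by (auto simp: convergent_def)
    then obtain a where a: "\<And>i. i < n \<Longrightarrow> (\<lambda>k. c k i) \<longlonglongrightarrow> a i" by metis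
    have "s \<longlonglongrightarrow> (\<Sum>i<n. a i *\<^sub>R b i)"
      unfolding s_def by (intro tendsto_intros) (use a in auto)
    with s have eq: "b n = (\<Sum>i<n. a i *\<^sub>R b i)" using LIMSEQ_unique by blast
    then have "(\<Sum>i<Suc n. (a(n := -1)) i *\<^sub>R b i) = 0" by simp
    from Suc.prems[OF this] show False by (metis fun_upd_same lessI neg_equal_0_iff_equal zero_neq_one)
  qed
  then obtain d where "d > 0" and d: "\<And>c. d \<le> norm (b n - (\<Sum>i<n. c i *\<^sub>R b i))" by blast
  define x where "x c = (\<Sum>i<Suc n. c i *\<^sub>R b i)" for c
  have last: "d * \<bar>c n\<bar> \<le> norm (x c)" for c
  proof (cases "c n = 0")
    case False
    have "x c = c n *\<^sub>R (b n - (\<Sum>i<n. (- c i / c n) *\<^sub>R b i))"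
      using False by (simp add: x_def scaleR_diff_right scaleR_add_right scaleR_sum_right sum_negf)
    then have "norm (x c) = \<bar>c n\<bar> * norm (b n - (\<Sum>i<n. (- c i / c n) *\<^sub>R b i))"
      by (metis norm_scaleR)
    with mult_left_mono[OF d[of "\<lambda>i. - c i / c n"], of "\<bar>c n\<bar>"] show ?thesis
      by (simp add: mult.commute)
  qed simp
  have "\<bar>c i\<bar> \<le> (K * (1 + norm (b n) / d) + 1 / d) * norm (x c)" if "i < Suc n" for c i
  proof (cases "i = n")
    case True
    have "\<bar>c n\<bar> \<le> (1 / d) * norm (x c)" using last[of c] \<open>d > 0\<close> by (simp add: field_simps)
    also have "\<dots> \<le> (K * (1 + norm (b n) / d) + 1 / d) * norm (x c)"
      using \<open>d > 0\<close> \<open>K \<ge> 0\<close> by (intro mult_right_mono) auto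
    finally show ?thesis by (simp add: True)
  next
    case False
    then have "i < n" using that by simp
    have "(\<Sum>i<n. c i *\<^sub>R b i) = x c - c n *\<^sub>R b n" by (simp add: x_def)
    then have "norm (\<Sum>i<n. c i *\<^sub>R b i) \<le> norm (x c) + \<bar>c n\<bar> * norm (b n)"
      by (metis norm_scaleR norm_triangle_ineq4)
    also have "\<dots> \<le> norm (x c) + (norm (x c) / d) * norm (b n)"
      using last[of c] \<open>d > 0\<close> by (intro add_left_mono mult_right_mono) (auto simp: field_simps)
    also have "\<dots> = (1 + norm (b n) / d) * norm (x c)" by (simp add: algebra_simps)
    finally have "\<bar>c i\<bar> \<le> K * ((1 + norm (b n) / d) * norm (x c))"
      using K[OF \<open>i < n\<close>, of c] \<open>K \<ge> 0\<close> by (meson mult_left_mono order_trans)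
    also have "\<dots> \<le> (K * (1 + norm (b n) / d) + 1 / d) * norm (x c)"
      using \<open>d > 0\<close> by (simp add: algebra_simps)
    finally show ?thesis .
  qed
  then show ?case unfolding x_def by blast
qed

lemma finite_dim_indexed_basis:
  fixes V :: "'a::real_normed_vector set"
  assumes "finite b" "V = span b"
  obtains e :: "nat \<Rightarrow> 'a" where
    "\<And>x. x \<in> V \<longleftrightarrow> (\<exists>c. x = (\<Sum>i<dim V. c i *\<^sub>R e i))"
    "\<And>c. (\<Sum>i<dim V. c i *\<^sub>R e i) = 0 \<Longrightarrow> \<forall>i<dim V. c i = 0"
proof -
  obtain B where B: "B \<subseteq> V" "independent B" "V \<subseteq> span B" "card B = dim V"
    by (rule real_vector.basis_exists)
  have "finite B"
    using real_vector.independent_span_bound[OF assms(1) B(2)] B(1) assms(2) by simp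
  then obtain e where e: "bij_betw e {..<dim V} B"
    using ex_bij_betw_nat_finite[of B] B(4) by (metis atLeast0LessThan)
  have "span B = V"
    using B assms(2) by (metis real_vector.span_minimal real_vector.subspace_span subset_antisym)
  have sums: "(\<Sum>x\<in>B. u x *\<^sub>R x) = (\<Sum>i<dim V. u (e i) *\<^sub>R e i)" for u
    by (rule sum.reindex_bij_betw[OF e, symmetric])
  have sums_inv: "(\<Sum>i<dim V. c i *\<^sub>R e i) = (\<Sum>x\<in>B. c (the_inv_into {..<dim V} e x) *\<^sub>R x)" for c
    unfolding sums by (rule sum.cong)
      (use e in \<open>auto simp: bij_betw_def the_inv_into_f_f\<close>)
  show thesis
  proof
    fix x show "x \<in> V \<longleftrightarrow> (\<exists>c. x = (\<Sum>i<dim V. c i *\<^sub>R e i))"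
    proof
      assume "x \<in> V"
      then obtain u where "x = (\<Sum>x\<in>B. u x *\<^sub>R x)"
        using \<open>span B = V\<close> real_vector.span_finite[OF \<open>finite B\<close>] by auto
      then show "\<exists>c. x = (\<Sum>i<dim V. c i *\<^sub>R e i)" unfolding sums by (intro exI[of _ "\<lambda>i. u (e i)"])
    next
      assume "\<exists>c. x = (\<Sum>i<dim V. c i *\<^sub>R e i)"
      then show "x \<in> V"
        using \<open>span B = V\<close> real_vector.span_finite[OF \<open>finite B\<close>] unfolding sums_inv by auto
    qed
  next
    fix c assume "(\<Sum>i<dim V. c i *\<^sub>R e i) = 0"
    then have z: "(\<Sum>x\<in>B. c (the_inv_into {..<dim V} e x) *\<^sub>R x) = 0" unfolding sums_inv .
    have "c (the_inv_into {..<dim V} e x) = 0" if "x \<in> B" for x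
      using real_vector.independentD[OF B(2) \<open>finite B\<close> subset_refl z that] .
    then show "\<forall>i<dim V. c i = 0"
      using e by (metis bij_betwE bij_betw_def lessThan_iff the_inv_into_f_f)
  qed
qed

lemma abs_det_le:
  fixes A :: "real mat"
  assumes A: "A \<in> carrier_mat n n" and K: "\<And>i j. i < n \<Longrightarrow> j < n \<Longrightarrow> \<bar>A $$ (i, j)\<bar> \<le> K"
  shows "\<bar>Determinant.det A\<bar> \<le> fact n * K ^ n"
proof -
  let ?P = "{p. p permutes {0..<n}}"
  have "\<bar>Determinant.det A\<bar> \<le> (\<Sum>p\<in>?P. \<bar>signof p * (\<Prod>i = 0..<n. A $$ (i, p i))\<bar>)"
    unfolding det_def'[OF A] by (rule sum_abs)
  also have "\<dots> \<le> (\<Sum>p\<in>?P. K ^ n)"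
  proof (rule sum_mono)
    fix p assume p: "p \<in> ?P"
    have "\<bar>\<Prod>i = 0..<n. A $$ (i, p i)\<bar> \<le> (\<Prod>i = 0..<n. K)"
      unfolding abs_prod using p
      by (intro prod_mono conjI K) (auto dest: permutes_in_image)
    then show "\<bar>signof p * (\<Prod>i = 0..<n. A $$ (i, p i))\<bar> \<le> K ^ n"
      by (simp add: abs_mult sign_def)
  qed
  also have "\<dots> = fact n * K ^ n"
    by (simp add: card_permutations[OF refl])
  finally show ?thesis .
qed

text \<open>
  Among all \<open>n\<close>-tuples in the unit ball of \<open>V\<close> choose one whose volume, measured by a determinant in
  fixed coordinates, is within the factor \<open>1 + \<eta>\<close> of the supremum. By Cramer's rule, replacing \<open>w i\<close>
  by a vector \<open>x\<close> of the unit ball multiplies the volume by \<open>\<bar>f i x\<bar>\<close>, and near-maximality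
  limits this factor to \<open>1 + \<eta>\<close>.
\<close>

lemma near_auerbach_basis:
  fixes V :: "'a::real_normed_vector set"
  assumes V: "finite b" "V = span b" and "\<eta> > 0"
  obtains w :: "nat \<Rightarrow> 'a" and f :: "nat \<Rightarrow> 'a \<Rightarrow> real" where
    "\<And>i. i < dim V \<Longrightarrow> norm (w i) \<le> 1"
    "\<And>x. x \<in> V \<Longrightarrow> x = (\<Sum>i<dim V. f i x *\<^sub>R w i)"
    "\<And>i x y. i < dim V \<Longrightarrow> x \<in> V \<Longrightarrow> y \<in> V \<Longrightarrow> f i (x - y) = f i x - f i y"
    "\<And>i x. i < dim V \<Longrightarrow> x \<in> V \<Longrightarrow> \<bar>f i x\<bar> \<le> (1 + \<eta>) * norm x"
proof -
  define n where "n = dim V"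
  obtain e where e: "\<And>x. x \<in> V \<longleftrightarrow> (\<exists>c. x = (\<Sum>i<n. c i *\<^sub>R e i))"
    and indep: "\<And>c. (\<Sum>i<n. c i *\<^sub>R e i) = 0 \<Longrightarrow> \<forall>i<n. c i = 0"
    using finite_dim_indexed_basis[OF V] unfolding n_def by metis
  have subspace: "subspace V" using V by simp
  obtain co where co: "\<And>x. x \<in> V \<Longrightarrow> x = (\<Sum>i<n. co x i *\<^sub>R e i)"
    using e by metis
  have uniq: "co x i = c i" if "x \<in> V" "x = (\<Sum>i<n. c i *\<^sub>R e i)" "i < n" for x c i
  proof -
    have "(\<Sum>i<n. (co x i - c i) *\<^sub>R e i) = 0"
      using co[OF that(1)] that(2) by (simp add: scaleR_diff_left sum_subtractf)
    from indep[OF this] that(3) show ?thesis by simp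
  qed
  have co_diff: "co (x - y) i = co x i - co y i" if "x \<in> V" "y \<in> V" "i < n" for x y i
    using that co[OF that(1)] co[OF that(2)] subspace
    by (intro uniq) (auto simp: subspace_diff scaleR_diff_left sum_subtractf)
  have co_scale: "co (a *\<^sub>R x) i = a * co x i" if "x \<in> V" "i < n" for a x i
  proof (rule uniq)
    show "a *\<^sub>R x = (\<Sum>i<n. (a * co x i) *\<^sub>R e i)"
      using arg_cong[OF co[OF that(1)], of "\<lambda>x. a *\<^sub>R x"] by (simp add: scaleR_sum_right)
  qed (use that subspace in \<open>auto simp: subspace_scale\<close>)
  have e_V: "e i \<in> V" and co_e: "j < n \<Longrightarrow> co (e i) j = (if i = j then 1 else 0)" if "i < n" for i j
  proof -
    have *: "e i = (\<Sum>j<n. (if i = j then 1 else 0) *\<^sub>R e j)"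
      using that by (simp add: if_distrib[of "\<lambda>c. c *\<^sub>R _"] cong: if_cong)
    then show "e i \<in> V" unfolding e by (rule exI[of _ "\<lambda>j. if i = j then 1 else 0"])
    then show "co (e i) j = (if i = j then 1 else 0)" if "j < n"
      using uniq[OF _ * that] by simp
  qed
  have e_nz: "e i \<noteq> 0" if "i < n" for i
    using co_e[OF that that] co_scale[OF e_V[OF that] that, of 0] by auto
  obtain K where K: "\<And>c i. i < n \<Longrightarrow> \<bar>c i\<bar> \<le> K * norm (\<Sum>i<n. c i *\<^sub>R e i)"
    using coordinates_bounded[OF indep] by metis
  have co_le: "\<bar>co x i\<bar> \<le> \<bar>K\<bar>" if "x \<in> V" "norm x \<le> 1" "i < n" for x i
  proof -
    have "\<bar>co x i\<bar> \<le> K * norm x" using K[OF that(3), of "co x"] co[OF that(1)] by simp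
    also have "\<dots> \<le> \<bar>K\<bar> * 1" using that by (intro mult_mono) auto
    finally show ?thesis by simp
  qed
  define A where "A w = mat n n (\<lambda>(j, i). co (w i) j)" for w :: "nat \<Rightarrow> 'a"
  have A: "A w \<in> carrier_mat n n" for w by (simp add: A_def)
  define vol where "vol w = \<bar>Determinant.det (A w)\<bar>" for w
  define adm where "adm = {w. \<forall>i<n. w i \<in> V \<and> norm (w i) \<le> 1}"
  have bdd: "bdd_above (vol ` adm)"
  proof (rule bdd_aboveI2)
    fix w assume "w \<in> adm"
    then show "vol w \<le> fact n * \<bar>K\<bar> ^ n"
      unfolding vol_def by (intro abs_det_le[OF A]) (auto simp: A_def adm_def intro: co_le)
  qed
  define s where "s = (SUP w\<in>adm. vol w)"
  have vol_le: "vol w \<le> s" if "w \<in> adm" for w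
    unfolding s_def using bdd that by (rule cSUP_upper2) simp
  \<comment> \<open>The normalised reference basis shows that the supremum is positive.\<close>
  define u where "u i = (1 / norm (e i)) *\<^sub>R e i" for i
  have u: "u \<in> adm" using e_V subspace e_nz by (auto simp: adm_def u_def subspace_scale)
  have "vol u > 0"
  proof -
    have co_u: "co (u i) j = (if i = j then 1 / norm (e i) else 0)" if "i < n" "j < n" for i j
      using that by (simp add: u_def co_scale e_V co_e)
    have "Determinant.det (A u) = prod_list (diag_mat (A u))"
      by (rule det_upper_triangular[OF _ A]) (auto simp: upper_triangular_def A_def co_u)
    moreover have "0 \<notin> set (diag_mat (A u))"
      by (auto simp: diag_mat_def A_def co_u e_nz)
    ultimately show ?thesis by (simp add: vol_def)
  qed
  then have "s > 0" using vol_le[OF u] by simp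
  then have "s / (1 + \<eta>) < s" using \<open>\<eta> > 0\<close> by (simp add: field_simps)
  then obtain w where w: "w \<in> adm" "s / (1 + \<eta>) < vol w"
    unfolding s_def using u less_cSUP_iff[OF _ bdd] by (metis empty_iff)
  have sw: "s \<le> (1 + \<eta>) * vol w" using w(2) \<open>\<eta> > 0\<close> by (simp add: field_simps)
  have "0 < s / (1 + \<eta>)" using \<open>\<eta> > 0\<close> \<open>s > 0\<close> by simp
  with w(2) have "vol w > 0" by linarith
  then obtain A' where A': "A' \<in> carrier_mat n n" "A w * A' = 1\<^sub>m n"
    using det_non_zero_imp_unit[OF A, of w "()"] unfolding Units_def
    by (auto simp: ring_mat_def vol_def)
  define X where "X x = vec n (co x)" for x
  have X: "X x \<in> carrier_vec n" for x by (simp add: X_def)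
  define f where "f i x = vec_index (A' *\<^sub>v X x) i" for i x
  have AX: "A w *\<^sub>v (A' *\<^sub>v X x) = X x" for x
    using A' A X by (metis assoc_mult_mat_vec one_mult_mat_vec)
  have diff: "f i (x - y) = f i x - f i y" if "i < n" "x \<in> V" "y \<in> V" for i x y
  proof -
    have "X (x - y) = X x - X y" by (rule eq_vecI) (auto simp: X_def co_diff that)
    then have "A' *\<^sub>v X (x - y) = A' *\<^sub>v X x - A' *\<^sub>v X y"
      by (simp add: mult_minus_distrib_mat_vec[OF A'(1) X X])
    then show ?thesis using that A' by (simp add: f_def)
  qed
  have scale: "f i (a *\<^sub>R x) = a * f i x" if "i < n" "x \<in> V" for i x a
  proof -
    have "X (a *\<^sub>R x) = a \<cdot>\<^sub>v X x" by (rule eq_vecI) (auto simp: X_def co_scale that)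
    then show ?thesis using that A' by (simp add: f_def mult_mat_vec[OF A'(1) X])
  qed
  have expand: "x = (\<Sum>i<n. f i x *\<^sub>R w i)" if "x \<in> V" for x
  proof -
    have wV: "i < n \<Longrightarrow> w i \<in> V" for i using w by (simp add: adm_def)
    have coj: "co x j = (\<Sum>i<n. co (w i) j * f i x)" if "j < n" for j
    proof -
      have "co x j = vec_index (A w *\<^sub>v (A' *\<^sub>v X x)) j" unfolding AX using that by (simp add: X_def)
      also have "\<dots> = (\<Sum>i<n. co (w i) j * f i x)"
        using that A' by (simp add: A_def scalar_prod_def f_def atLeast0LessThan)
      finally show ?thesis .
    qed
    have "(\<Sum>i<n. f i x *\<^sub>R w i) = (\<Sum>i<n. f i x *\<^sub>R (\<Sum>j<n. co (w i) j *\<^sub>R e j))"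
      using co[OF wV] by simp
    also have "\<dots> = (\<Sum>i<n. \<Sum>j<n. (co (w i) j * f i x) *\<^sub>R e j)"
      by (simp add: scaleR_sum_right mult.commute)
    also have "\<dots> = (\<Sum>j<n. (\<Sum>i<n. co (w i) j * f i x) *\<^sub>R e j)"
      by (subst sum.swap) (simp add: scaleR_sum_left)
    also have "\<dots> = x" using co[OF that] coj by simp
    finally show ?thesis by simp
  qed
  have unit: "\<bar>f i x\<bar> \<le> 1 + \<eta>" if "i < n" "x \<in> V" "norm x \<le> 1" for i x
  proof -
    have "A (w(i := x)) = replace_col (A w) (X x) i"
      using that by (intro eq_matI) (auto simp: A_def replace_col_def X_def)
    then have "Determinant.det (A (w(i := x))) = f i x * Determinant.det (A w)"
      using cramer_lemma_mat[OF A, of "A' *\<^sub>v X x" i w] A' that AX[of x]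
      by (simp add: f_def mult_mat_vec_carrier[OF _ X])
    then have "\<bar>f i x\<bar> * vol w = vol (w(i := x))" by (simp add: vol_def abs_mult)
    also have "\<dots> \<le> s" using w that by (intro vol_le) (auto simp: adm_def)
    also have "\<dots> \<le> (1 + \<eta>) * vol w" by (rule sw)
    finally show ?thesis using \<open>vol w > 0\<close> by simp
  qed
  have bound: "\<bar>f i x\<bar> \<le> (1 + \<eta>) * norm x" if "i < n" "x \<in> V" for i x
  proof -
    have x: "x = norm x *\<^sub>R ((1 / norm x) *\<^sub>R x)" by (cases "x = 0") auto
    have "(1 / norm x) *\<^sub>R x \<in> V" using that subspace by (simp add: subspace_scale)
    moreover have "norm ((1 / norm x) *\<^sub>R x) \<le> 1" by simp
    ultimately have "norm x * \<bar>f i ((1 / norm x) *\<^sub>R x)\<bar> \<le> norm x * (1 + \<eta>)"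
      using unit[OF that(1)] by (intro mult_left_mono) auto
    moreover have "f i x = norm x * f i ((1 / norm x) *\<^sub>R x)"
      using scale[OF that(1) \<open>(1 / norm x) *\<^sub>R x \<in> V\<close>, of "norm x"] x by simp
    ultimately show ?thesis by (simp add: abs_mult mult.commute)
  qed
  show thesis
    by (rule that[of w f]) (use w diff expand bound in \<open>auto simp: n_def adm_def\<close>)
qed

text \<open>
  In a nearly Auerbach basis each coordinate varies over \<open>A\<close> by at most \<open>(1 + \<eta>) * D\<close>; cut this range into intervals of length
  \<open>h / dim V\<close>, so that the \<open>dim V\<close> coordinate differences of two points in the same cell add up to
  at most \<open>h\<close>. The label \<open>g x\<close> lists the interval indices of \<open>x\<close>. The strict inequality for \<open>q\<close> leaves
  room for \<open>\<eta>\<close>.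
\<close>

lemma finite_dim_partition:
  fixes V :: "'a::real_normed_vector set"
  assumes V: "finite b" "V = span b" and "h > 0" "D > 0"
    and q: "real (dim V) * D / h < real q"
    and A: "A \<subseteq> V" "\<And>x y. x \<in> A \<Longrightarrow> y \<in> A \<Longrightarrow> norm (x - y) \<le> D"
  obtains g :: "'a \<Rightarrow> nat \<Rightarrow> nat" where
    "g ` A \<subseteq> {..<dim V} \<rightarrow>\<^sub>E {..<q}"
    "\<And>x y. x \<in> A \<Longrightarrow> y \<in> A \<Longrightarrow> g x = g y \<Longrightarrow> norm (x - y) \<le> h"
proof (cases "dim V = 0")
  case True
  have "V \<subseteq> {0}"
  proof -
    obtain w f where "\<And>x. x \<in> V \<Longrightarrow> x = (\<Sum>i<dim V. f i x *\<^sub>R w i)"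
      by (rule near_auerbach_basis[OF V, of 1]) auto
    with True show ?thesis by auto
  qed
  have small: "norm (x - y) \<le> h" if "x \<in> A" "y \<in> A" for x y
  proof -
    have "x = 0" "y = 0" using that A(1) \<open>V \<subseteq> {0}\<close> by blast+
    then show ?thesis using \<open>h > 0\<close> by simp
  qed
  show thesis by (rule that[of "\<lambda>_ _. undefined"]) (auto simp: True intro: small)
next
  case False
  define n where "n = dim V"
  have "n > 0" using False by (simp add: n_def)
  define t where "t = real n * D / h"
  have "t > 0" using \<open>n > 0\<close> assms by (simp add: t_def)
  \<comment> \<open>This value makes \<open>(1 + \<eta>) * t\<close> the midpoint of \<open>t\<close> and \<open>q\<close>.\<close>
  define \<eta> where "\<eta> = (q - t) / (2 * t)"
  have "\<eta> > 0" using q[folded n_def, folded t_def] \<open>t > 0\<close> by (simp add: \<eta>_def)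
  have \<eta>: "(1 + \<eta>) * t < q"
    using q[folded n_def, folded t_def] \<open>t > 0\<close> by (simp add: \<eta>_def field_simps)
  obtain w f where w: "\<And>i. i < n \<Longrightarrow> norm (w i) \<le> 1"
    and expand: "\<And>x. x \<in> V \<Longrightarrow> x = (\<Sum>i<n. f i x *\<^sub>R w i)"
    and diff: "\<And>i x y. i < n \<Longrightarrow> x \<in> V \<Longrightarrow> y \<in> V \<Longrightarrow> f i (x - y) = f i x - f i y"
    and bound: "\<And>i x. i < n \<Longrightarrow> x \<in> V \<Longrightarrow> \<bar>f i x\<bar> \<le> (1 + \<eta>) * norm x"
    by (rule near_auerbach_basis[OF V \<open>\<eta> > 0\<close>, folded n_def]) (rule that)
  have subspace: "subspace V" using V by simp
  have range: "f i x - f i y \<le> (1 + \<eta>) * D" if "i < n" "x \<in> A" "y \<in> A" for i x y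
  proof -
    have xy: "x \<in> V" "y \<in> V" using that A by auto
    then have "\<bar>f i (x - y)\<bar> \<le> (1 + \<eta>) * norm (x - y)"
      using that subspace by (intro bound) (auto simp: subspace_diff)
    also have "\<dots> \<le> (1 + \<eta>) * D" using A that \<open>\<eta> > 0\<close> by (intro mult_left_mono) auto
    finally show ?thesis using diff[OF that(1) xy] by simp
  qed
  define m where "m i = (INF y\<in>A. f i y)" for i
  have m: "m i \<le> f i x" "f i x - m i \<le> (1 + \<eta>) * D" if "i < n" "x \<in> A" for i x
  proof -
    have "bdd_below (f i ` A)"
      by (rule bdd_belowI2[of _ "f i x - (1 + \<eta>) * D"]) (use range[OF that(1) that(2)] in force)
    then show "m i \<le> f i x" unfolding m_def using that by (intro cINF_lower)
    have "f i x - (1 + \<eta>) * D \<le> m i"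
      unfolding m_def using that range[OF that] by (intro cINF_greatest) (auto simp: algebra_simps)
    then show "f i x - m i \<le> (1 + \<eta>) * D" by simp
  qed
  define l where "l = h / real n"
  have "l > 0" using \<open>n > 0\<close> \<open>h > 0\<close> by (simp add: l_def)
  define g where "g x = (\<lambda>i\<in>{..<n}. nat \<lfloor>(f i x - m i) / l\<rfloor>)" for x
  have nonneg: "0 \<le> (f i x - m i) / l" if "i < n" "x \<in> A" for i x
    using m(1)[OF that] \<open>l > 0\<close> by simp
  show thesis
  proof (rule that[of g])
    have "g x i < q" if "i < n" "x \<in> A" for x i
    proof -
      have "(f i x - m i) / l \<le> (1 + \<eta>) * D / l"
        using m(2)[OF that] \<open>l > 0\<close> by (intro divide_right_mono) auto
      also have "\<dots> = (1 + \<eta>) * t" by (simp add: l_def t_def)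
      also have "\<dots> < q" by (rule \<eta>)
      finally show ?thesis using nonneg[OF that] that by (simp add: g_def floor_less_iff nat_less_iff)
    qed
    then show "g ` A \<subseteq> {..<dim V} \<rightarrow>\<^sub>E {..<q}"
      by (auto simp: n_def[symmetric] g_def split: if_splits)
  next
    fix x y assume xy: "x \<in> A" "y \<in> A" "g x = g y"
    then have "x \<in> V" "y \<in> V" using A by auto
    have close: "\<bar>f i (x - y)\<bar> \<le> l" if "i < n" for i
    proof -
      have "nat \<lfloor>(f i x - m i) / l\<rfloor> = nat \<lfloor>(f i y - m i) / l\<rfloor>"
        using fun_cong[OF xy(3), of i] that by (simp add: g_def)
      then have "\<lfloor>(f i x - m i) / l\<rfloor> = \<lfloor>(f i y - m i) / l\<rfloor>"
        using nonneg[OF that xy(1)] nonneg[OF that xy(2)] by (simp add: eq_nat_nat_iff)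
      then have "\<bar>(f i x - m i) / l - (f i y - m i) / l\<bar> \<le> 1" by linarith
      then have "\<bar>f i x - f i y\<bar> \<le> l"
        using \<open>l > 0\<close> by (simp add: diff_divide_distrib[symmetric])
      then show ?thesis using diff[OF that \<open>x \<in> V\<close> \<open>y \<in> V\<close>] by simp
    qed
    have "norm (x - y) = norm (\<Sum>i<n. f i (x - y) *\<^sub>R w i)"
      using expand subspace \<open>x \<in> V\<close> \<open>y \<in> V\<close> by (metis subspace_diff)
    also have "\<dots> \<le> (\<Sum>i<n. norm (f i (x - y) *\<^sub>R w i))" by (rule norm_sum)
    also have "\<dots> \<le> (\<Sum>i<n. l * 1)"
      unfolding norm_scaleR using close w \<open>l > 0\<close>
      by (intro sum_mono mult_mono) auto
    also have "\<dots> = h" using \<open>n > 0\<close> by (simp add: l_def)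
    finally show "norm (x - y) \<le> h" .
  qed
qed

section \<open>One step of the covering\<close>

text \<open>
  The covering sets need not be subsets of \<open>A\<close>, and their size is measured by diameter, so no choice
  of centres is involved.
\<close>

definition covered_by_small_sets :: "nat \<Rightarrow> real \<Rightarrow> 'a::real_normed_vector set \<Rightarrow> bool" where
  "covered_by_small_sets N d A \<longleftrightarrow>
     (\<exists>F. finite F \<and> card F \<le> N \<and> A \<subseteq> \<Union>F \<and> (\<forall>U\<in>F. \<forall>x\<in>U. \<forall>y\<in>U. norm (x - y) \<le> d))"

lemma covered_by_small_setsE:
  assumes "covered_by_small_sets N d A"
  obtains F where "finite F" "card F \<le> N" "A \<subseteq> \<Union>F"
    "\<And>U x y. U \<in> F \<Longrightarrow> x \<in> U \<Longrightarrow> y \<in> U \<Longrightarrow> norm (x - y) \<le> d"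
proof -
  from assms obtain F where F: "finite F \<and> card F \<le> N \<and> A \<subseteq> \<Union>F \<and>
      (\<forall>U\<in>F. \<forall>x\<in>U. \<forall>y\<in>U. norm (x - y) \<le> d)"
    unfolding covered_by_small_sets_def ..
  show thesis by (rule that[of F]) (use F in simp_all)
qed

text \<open>
  The constant \<open>p\<close> bounds the expansion of the finite-dimensional part, \<open>r\<close> that of the complementary
  part, and \<open>a\<close> is the mesh, relative to \<open>d\<close>, at which the finite-dimensional part is cut. Each
  covering set \<open>U\<close> gives one piece for every label of the partition of \<open>P ` f ` (U \<inter> A)\<close>.
\<close>

lemma covered_by_small_sets_image:
  fixes f :: "'a::real_normed_vector \<Rightarrow> 'b::real_normed_vector" and P :: "'b \<Rightarrow> 'b"
  assumes V: "finite b" "range P = span b"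
    and pos: "d > 0" "p > 0" "a > 0" and q: "real (dim (range P)) * p / a < real q"
    and P_est: "\<And>x y. x \<in> A \<Longrightarrow> y \<in> A \<Longrightarrow> norm (P (f x) - P (f y)) \<le> p * norm (x - y)"
    and Q_est: "\<And>x y. x \<in> A \<Longrightarrow> y \<in> A \<Longrightarrow>
                  norm ((f x - P (f x)) - (f y - P (f y))) \<le> r * norm (x - y)" and "r \<ge> 0"
    and cov: "covered_by_small_sets N d A"
  shows "covered_by_small_sets (N * q ^ dim (range P)) ((a + r) * d) (f ` A)"
proof -
  let ?G = "{..<dim (range P)} \<rightarrow>\<^sub>E {..<q}"
  obtain F where F: "finite F" "card F \<le> N" "A \<subseteq> \<Union>F"
      "\<And>U x y. U \<in> F \<Longrightarrow> x \<in> U \<Longrightarrow> y \<in> U \<Longrightarrow> norm (x - y) \<le> d"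
    by (rule covered_by_small_setsE[OF cov]) (rule that)
  have "\<exists>g :: 'b \<Rightarrow> nat \<Rightarrow> nat. g ` (P ` f ` (U \<inter> A)) \<subseteq> ?G \<and>
          (\<forall>x\<in>U \<inter> A. \<forall>y\<in>U \<inter> A. g (P (f x)) = g (P (f y)) \<longrightarrow> norm (P (f x) - P (f y)) \<le> a * d)"
    if "U \<in> F" for U
  proof -
    have "norm (x - y) \<le> p * d" if xy: "x \<in> P ` f ` (U \<inter> A)" "y \<in> P ` f ` (U \<inter> A)" for x y
    proof -
      obtain x' y' where *: "x' \<in> U \<inter> A" "y' \<in> U \<inter> A" "x = P (f x')" "y = P (f y')"
        using xy by blast
      then have "norm (x - y) \<le> p * norm (x' - y')" using P_est by simp
      also have "\<dots> \<le> p * d" using * F(4)[OF \<open>U \<in> F\<close>] pos by (intro mult_left_mono) auto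
      finally show ?thesis .
    qed
    moreover have "real (dim (range P)) * (p * d) / (a * d) < real q" using q pos by simp
    moreover have "P ` f ` (U \<inter> A) \<subseteq> range P" by blast
    ultimately obtain g :: "'b \<Rightarrow> nat \<Rightarrow> nat" where "g ` (P ` f ` (U \<inter> A)) \<subseteq> ?G"
        "\<And>x y. x \<in> P ` f ` (U \<inter> A) \<Longrightarrow> y \<in> P ` f ` (U \<inter> A) \<Longrightarrow> g x = g y \<Longrightarrow> norm (x - y) \<le> a * d"
      using finite_dim_partition[OF V, of "a * d" "p * d" q "P ` f ` (U \<inter> A)"] pos
      by (metis mult_pos_pos)
    then show ?thesis by (intro exI[of _ g]) blast
  qed
  then obtain g :: "'a set \<Rightarrow> 'b \<Rightarrow> nat \<Rightarrow> nat" where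
    g: "\<And>U. U \<in> F \<Longrightarrow> g U ` (P ` f ` (U \<inter> A)) \<subseteq> ?G"
    and gd: "\<And>U x y. U \<in> F \<Longrightarrow> x \<in> U \<inter> A \<Longrightarrow> y \<in> U \<inter> A \<Longrightarrow>
               g U (P (f x)) = g U (P (f y)) \<Longrightarrow> norm (P (f x) - P (f y)) \<le> a * d"
    by metis
  define T where "T = (\<lambda>(U, s). f ` {x \<in> U \<inter> A. g U (P (f x)) = s})"
  have finG: "finite ?G" by (intro finite_PiE) auto
  show ?thesis unfolding covered_by_small_sets_def
  proof (intro exI conjI ballI)
    show "finite (T ` (F \<times> ?G))" using F finG by blast
    have "card (T ` (F \<times> ?G)) \<le> card (F \<times> ?G)" using F finG by (intro card_image_le) blast
    also have "\<dots> \<le> N * q ^ dim (range P)"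
      using F by (simp add: card_cartesian_product card_PiE)
    finally show "card (T ` (F \<times> ?G)) \<le> N * q ^ dim (range P)" .
    show "f ` A \<subseteq> \<Union> (T ` (F \<times> ?G))"
    proof
      fix z assume "z \<in> f ` A"
      then obtain x where x: "x \<in> A" "z = f x" by blast
      then obtain U where U: "U \<in> F" "x \<in> U" using F by blast
      then have "g U (P (f x)) \<in> ?G" using g[OF U(1)] x by blast
      with U have "(U, g U (P (f x))) \<in> F \<times> ?G" by blast
      moreover have "z \<in> T (U, g U (P (f x)))" using U x by (simp add: T_def)
      ultimately show "z \<in> \<Union> (T ` (F \<times> ?G))" by blast
    qed
    fix Z z z' assume "Z \<in> T ` (F \<times> ?G)" "z \<in> Z" "z' \<in> Z"
    then obtain U s x x' where *: "U \<in> F" "x \<in> U \<inter> A" "x' \<in> U \<inter> A" "g U (P (f x)) = s"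
       "g U (P (f x')) = s" "z = f x" "z' = f x'" unfolding T_def by auto
    have "norm (z - z') \<le> norm (P z - P z') + norm ((z - P z) - (z' - P z'))"
      by (rule order_trans[OF _ norm_triangle_ineq]) (simp add: algebra_simps)
    also have "\<dots> \<le> a * d + r * norm (x - x')"
      using * by (intro add_mono) (auto intro: gd Q_est)
    also have "\<dots> \<le> a * d + r * d"
      using * F(4)[of U x x'] \<open>r \<ge> 0\<close> by (intro add_left_mono mult_left_mono) auto
    finally show "norm (z - z') \<le> (a + r) * d" by (simp add: algebra_simps)
  qed
qed

lemma covered_by_small_sets_net:
  assumes "covered_by_small_sets N d A"
  shows "\<exists>W. finite W \<and> card W \<le> N \<and> W \<subseteq> A \<and> (\<forall>x\<in>A. \<exists>y\<in>W. dist x y \<le> d)"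
proof -
  obtain F where F: "finite F" "card F \<le> N" "A \<subseteq> \<Union>F"
      "\<And>U x y. U \<in> F \<Longrightarrow> x \<in> U \<Longrightarrow> y \<in> U \<Longrightarrow> norm (x - y) \<le> d"
    by (rule covered_by_small_setsE[OF assms]) (rule that)
  define F' where "F' = {U \<in> F. U \<inter> A \<noteq> {}}"
  have "\<forall>U\<in>F'. \<exists>y. y \<in> U \<inter> A"
  proof
    fix U assume "U \<in> F'"
    then have "U \<inter> A \<noteq> {}" by (simp add: F'_def)
    then show "\<exists>y. y \<in> U \<inter> A" unfolding ex_in_conv .
  qed
  from bchoice[OF this] obtain y where y: "\<forall>U\<in>F'. y U \<in> U \<inter> A" ..
  show ?thesis
  proof (intro exI conjI ballI)
    have "finite F'" using F(1) by (simp add: F'_def)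
    then show "finite (y ` F')" by simp
    have "card (y ` F') \<le> card F'" by (rule card_image_le) fact
    also have "\<dots> \<le> card F" using F(1) by (intro card_mono) (simp_all add: F'_def)
    finally show "card (y ` F') \<le> N" using F(2) by simp
    show "y ` F' \<subseteq> A" using y by blast
    fix x assume "x \<in> A"
    then obtain U where "U \<in> F" "x \<in> U" using F(3) by (auto simp: subset_iff)
    have "U \<in> F'" using \<open>U \<in> F\<close> \<open>x \<in> A\<close> \<open>x \<in> U\<close> by (auto simp: F'_def)
    with y have "y U \<in> U" by blast
    with F(4)[OF \<open>U \<in> F\<close> \<open>x \<in> U\<close>] have "dist x (y U) \<le> d" by (simp add: dist_norm)
    with \<open>U \<in> F'\<close> show "\<exists>z\<in>y ` F'. dist x z \<le> d" by (intro bexI[of _ "y U"]) auto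
  qed
qed

section \<open>Construction of the attractor\<close>

text \<open>
  Here \<open>E k\<close> collects the points \<open>f ^^ (k - l) ` W l\<close> with \<open>l \<le> k\<close>. The map sends \<open>E k\<close> into
  \<open>E (Suc k)\<close>, which makes the closure of the union invariant, while the inclusion
  \<open>E k \<subseteq> f ^^ k ` B\<close> lets the single net \<open>W m\<close> cover all \<open>E k\<close> with \<open>k \<ge> m\<close>.
\<close>

lemma dynamical_attractor_from_coverings:
  fixes f :: "'a::complete_space \<Rightarrow> 'a" and r :: "nat \<Rightarrow> real"
  assumes cont: "continuous_on UNIV f" and "B \<noteq> {}" and inv: "f ` B \<subseteq> B"
    and N: "N \<ge> 1" and r: "r \<longlonglongrightarrow> 0" "\<And>k. r k > 0"
    and cover: "\<And>k. \<exists>W. finite W \<and> card W \<le> N ^ k \<and> W \<subseteq> (f ^^ k) ` B \<and>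
                   (\<forall>x\<in>(f ^^ k) ` B. \<exists>y\<in>W. dist x y \<le> r k)"
  shows "\<exists>M. M \<noteq> {} \<and> compact M \<and> f ` M \<subseteq> M \<and>
           (\<forall>k. \<forall>x\<in>(f ^^ k) ` B. \<exists>y\<in>M. dist x y \<le> r k) \<and>
           (\<forall>k. \<exists>C. finite C \<and> card C \<le> (k\<^sup>2 + k + 1) * N ^ k \<and> M \<subseteq> (\<Union>c\<in>C. ball c (2 * r k)))"
proof -
  obtain W where W: "\<And>k. finite (W k)" "\<And>k. card (W k) \<le> N ^ k" "\<And>k. W k \<subseteq> (f ^^ k) ` B"
      "\<And>k x. x \<in> (f ^^ k) ` B \<Longrightarrow> \<exists>y\<in>W k. dist x y \<le> r k"
    using cover by metis
  define E where "E k = (\<Union>l\<le>k. (f ^^ (k - l)) ` W l)" for k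
  have E_fin: "finite (E k)" for k by (simp add: E_def W)
  have E_card: "card (E k) \<le> (k + 1) * N ^ k" for k
  proof -
    have "card (E k) \<le> (\<Sum>l\<le>k. card ((f ^^ (k - l)) ` W l))"
      unfolding E_def by (rule card_UN_le) simp
    also have "\<dots> \<le> (\<Sum>l\<le>k. N ^ k)"
    proof (rule sum_mono)
      fix l assume "l \<in> {..k}"
      have "card ((f ^^ (k - l)) ` W l) \<le> card (W l)" by (rule card_image_le[OF W(1)])
      also have "\<dots> \<le> N ^ l" by (rule W)
      also have "\<dots> \<le> N ^ k" using \<open>l \<in> {..k}\<close> N by (intro power_increasing) auto
      finally show "card ((f ^^ (k - l)) ` W l) \<le> N ^ k" .
    qed
    finally show ?thesis by simp
  qed
  have pow: "(f ^^ (m + k)) ` B \<subseteq> (f ^^ m) ` B" for m k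
  proof -
    have "(f ^^ k) ` B \<subseteq> B"
      by (induction k) (use inv in auto)
    then show ?thesis by (auto simp: funpow_add)
  qed
  have E_sub: "E k \<subseteq> (f ^^ k) ` B" for k
  proof
    fix x assume "x \<in> E k"
    then obtain l y where l: "l \<le> k" "y \<in> W l" "x = (f ^^ (k - l)) y" by (auto simp: E_def)
    with W(3) obtain z where "z \<in> B" "y = (f ^^ l) z" by blast
    with l have "x = (f ^^ k) z" by (metis comp_apply funpow_add le_add_diff_inverse2)
    with \<open>z \<in> B\<close> show "x \<in> (f ^^ k) ` B" by blast
  qed
  have E_step: "f ` E k \<subseteq> E (Suc k)" for k
  proof
    fix x assume "x \<in> f ` E k"
    then obtain l y where "l \<le> k" "y \<in> W l" "x = f ((f ^^ (k - l)) y)" by (auto simp: E_def)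
    then have "l \<le> Suc k" "y \<in> W l" "x = (f ^^ (Suc k - l)) y" by (auto simp: Suc_diff_le)
    then show "x \<in> E (Suc k)" unfolding E_def by blast
  qed
  define M where "M = closure (\<Union>k. E k)"
  have W_M: "W k \<subseteq> M" for k
  proof -
    have "W k = (f ^^ (k - k)) ` W k" by simp
    then have "W k \<subseteq> E k" unfolding E_def by blast
    also have "\<dots> \<subseteq> (\<Union>k. E k)" by blast
    also have "\<dots> \<subseteq> M" unfolding M_def by (rule closure_subset)
    finally show ?thesis .
  qed
  have attr: "\<exists>y\<in>M. dist x y \<le> r k" if "x \<in> (f ^^ k) ` B" for k x
    using W(4)[OF that] W_M by blast
  have "M \<noteq> {}" using attr[of _ 0] \<open>B \<noteq> {}\<close> by auto
  have "f ` M \<subseteq> M"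
  proof -
    have "f ` M \<subseteq> closure (f ` (\<Union>k. E k))"
      unfolding M_def by (rule image_closure_subset[OF continuous_on_subset[OF cont]])
        (auto simp: closure_subset)
    also have "\<dots> \<subseteq> M"
      unfolding M_def by (rule closure_mono) (use E_step in blast)
    finally show ?thesis .
  qed
  have cov: "\<exists>C. finite C \<and> card C \<le> (m\<^sup>2 + m + 1) * N ^ m \<and> M \<subseteq> (\<Union>c\<in>C. ball c (2 * r m))" for m
  proof (intro exI conjI)
    \<comment> \<open>Closed balls of radius \<open>r m\<close> survive taking the closure; doubling the radius makes them open.\<close>
    let ?C = "(\<Union>k<m. E k) \<union> W m"
    show "finite ?C" by (simp add: E_fin W)
    have "card (\<Union>k<m. E k) \<le> (\<Sum>k<m. card (E k))" by (rule card_UN_le) simp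
    also have "\<dots> \<le> (\<Sum>k<m. (m + 1) * N ^ m)"
    proof (rule sum_mono)
      fix k assume "k \<in> {..<m}"
      then have "(k + 1) * N ^ k \<le> (m + 1) * N ^ m"
        using N by (intro mult_mono power_increasing) auto
      then show "card (E k) \<le> (m + 1) * N ^ m" using E_card order_trans by blast
    qed
    finally have "card (\<Union>k<m. E k) \<le> m * (m + 1) * N ^ m" by (simp add: algebra_simps)
    then show "card ?C \<le> (m\<^sup>2 + m + 1) * N ^ m"
      using card_Un_le[of "\<Union>k<m. E k" "W m"] W(2)[of m]
      by (simp add: algebra_simps power2_eq_square)
    have "(\<Union>k. E k) \<subseteq> (\<Union>c\<in>?C. cball c (r m))"
    proof
      fix x assume "x \<in> (\<Union>k. E k)"
      then obtain k where k: "x \<in> E k" by blast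
      show "x \<in> (\<Union>c\<in>?C. cball c (r m))"
      proof (cases "k < m")
        case True
        with k show ?thesis using r(2)[of m] by (auto intro!: bexI[of _ x] less_imp_le)
      next
        case False
        then have "x \<in> (f ^^ m) ` B" using k E_sub pow[of m "k - m"] by fastforce
        from W(4)[OF this] show ?thesis by (auto simp: dist_commute)
      qed
    qed
    moreover have "closed (\<Union>c\<in>?C. cball c (r m))" by (intro closed_UN \<open>finite ?C\<close>) auto
    ultimately have "M \<subseteq> (\<Union>c\<in>?C. cball c (r m))" unfolding M_def by (rule closure_minimal)
    also have "\<dots> \<subseteq> (\<Union>c\<in>?C. ball c (2 * r m))"
    proof (rule UN_mono)
      show "cball c (r m) \<subseteq> ball c (2 * r m)" for c :: 'a using r(2)[of m] by auto
    qed simp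
    finally show "M \<subseteq> (\<Union>c\<in>?C. ball c (2 * r m))" .
  qed
  have "compact M" unfolding compact_eq_totally_bounded
  proof (intro conjI allI impI)
    show "complete M" by (simp add: M_def complete_eq_closed)
    fix e :: real assume "e > 0"
    then have "e / 2 > 0" by simp
    from order_tendstoD(2)[OF r(1) this] obtain m where "r m < e / 2"
      unfolding eventually_sequentially by blast
    then have m: "2 * r m < e" by simp
    from cov[of m] obtain C where C: "finite C" "M \<subseteq> (\<Union>c\<in>C. ball c (2 * r m))" by blast
    note C(2)
    also have "(\<Union>c\<in>C. ball c (2 * r m)) \<subseteq> (\<Union>c\<in>C. ball c e)"
      using m by (intro UN_mono subset_ball) auto
    finally show "\<exists>k. finite k \<and> M \<subseteq> (\<Union>x\<in>k. ball x e)" using C(1) by blast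
  qed
  show ?thesis
    by (intro exI[of _ M] conjI allI ballI cov) (fact | erule attr)+
qed

section \<open>Fractal dimension\<close>

lemma covering_number_le:
  assumes "finite C" "A \<subseteq> (\<Union>c\<in>C. ball c \<epsilon>)"
  shows "covering_number \<epsilon> A \<le> enat (card C)"
  unfolding covering_number_def using assms by (intro Inf_lower) auto

lemma covering_number_ge_1:
  assumes "A \<noteq> {}"
  shows "covering_number \<epsilon> A \<ge> 1"
  unfolding covering_number_def
proof (rule Inf_greatest)
  fix x assume "x \<in> {enat (card C) | C. finite C \<and> A \<subseteq> (\<Union>c\<in>C. ball c \<epsilon>)}"
  then obtain C where C: "x = enat (card C)" "finite C" "A \<subseteq> (\<Union>c\<in>C. ball c \<epsilon>)" by blast
  with assms have "card C > 0" by (auto simp: card_gt_0_iff)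
  with C show "1 \<le> x" by (simp add: one_enat_def)
qed

text \<open>
  An exponential attractor has finite dimension as an extended real, so the value \<open>-\<infinity>\<close> has to be
  excluded as well.
\<close>

lemma fractal_dim_nonneg:
  assumes "A \<noteq> {}"
  shows "fractal_dim A \<ge> 0"
  unfolding fractal_dim_def
proof (rule le_Limsup)
  have "0 < \<epsilon> \<Longrightarrow> \<epsilon> < 1 \<Longrightarrow> 0 \<le> (case covering_number \<epsilon> A of
          enat N \<Rightarrow> ereal (ln (real N)) | \<infinity> \<Rightarrow> \<infinity>) / ereal (ln (1 / \<epsilon>))" for \<epsilon> :: real
    using covering_number_ge_1[OF assms, of \<epsilon>]
    by (auto split: enat.split simp: one_enat_def intro!: divide_nonneg_nonneg)
  then show "\<forall>\<^sub>F \<epsilon> in at_right 0. 0 \<le> (case covering_number \<epsilon> A of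
          enat N \<Rightarrow> ereal (ln (real N)) | \<infinity> \<Rightarrow> \<infinity>) / ereal (ln (1 / \<epsilon>))"
    unfolding eventually_at_right_field by (intro exI[of _ 1]) auto
qed simp

text \<open>
  For small \<open>\<epsilon>\<close> take the least \<open>k\<close> with \<open>d * z ^ k \<le> \<epsilon>\<close>. It is at most
  \<open>x \<epsilon> = (ln (1 / \<epsilon>) + ln d) / (- ln z) + 1\<close>, so the quotient of logarithms is at most a function \<open>g\<close>
  of \<open>\<epsilon>\<close> alone, in which the polynomial factor contributes only \<open>O(ln (ln (1 / \<epsilon>)))\<close> to the numerator.
\<close>

lemma fractal_dim_le_of_geometric_coverings:
  fixes M :: "'a::metric_space set" and N :: nat
  assumes "M \<noteq> {}" "N \<ge> 1" and z: "0 < z" "z < 1" and "d > 0"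
    and cov: "\<And>k. \<exists>C. finite C \<and> card C \<le> (k\<^sup>2 + k + 1) * N ^ k \<and>
                     M \<subseteq> (\<Union>c\<in>C. ball c (d * z ^ k))"
  shows "fractal_dim M \<le> ereal (ln (real N) / (- ln z))"
proof -
  define \<sigma> where "\<sigma> = - ln z"
  have "\<sigma> > 0" using z by (simp add: \<sigma>_def)
  define L where "L = ln (real N)"
  have "L \<ge> 0" using \<open>N \<ge> 1\<close> by (simp add: L_def)
  define c where "c = ln d"
  define x where "x \<epsilon> = (ln (1 / \<epsilon>) + c) / \<sigma> + 1" for \<epsilon> :: real
  define g where "g \<epsilon> = (ln ((x \<epsilon>)\<^sup>2 + x \<epsilon> + 1) + x \<epsilon> * L) / ln (1 / \<epsilon>)" for \<epsilon>
  have bound: "(case covering_number \<epsilon> M of enat N \<Rightarrow> ereal (ln (real N)) | \<infinity> \<Rightarrow> \<infinity>)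
       / ereal (ln (1 / \<epsilon>)) \<le> ereal (g \<epsilon>)" if \<epsilon>: "0 < \<epsilon>" "\<epsilon> < min 1 d" for \<epsilon>
  proof -
    define y where "y = (ln (1 / \<epsilon>) + c) / \<sigma>"
    have "ln (1 / \<epsilon>) + c = ln (d / \<epsilon>)" using \<epsilon> \<open>d > 0\<close> by (simp add: c_def ln_div)
    then have "y \<ge> 0" using \<epsilon> \<open>\<sigma> > 0\<close> by (simp add: y_def)
    define k where "k = nat \<lceil>y\<rceil>"
    have k: "y \<le> real k" "real k \<le> y + 1" using \<open>y \<ge> 0\<close> unfolding k_def by linarith+
    have kx: "real k \<le> x \<epsilon>" using k by (simp add: x_def y_def)
    have "ln (d * z ^ k) \<le> ln \<epsilon>"
    proof -
      have "ln (d * z ^ k) = c - real k * \<sigma>"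
        using \<open>d > 0\<close> z by (simp add: ln_mult ln_realpow c_def \<sigma>_def)
      also have "\<dots> \<le> c - y * \<sigma>" using k \<open>\<sigma> > 0\<close> by simp
      also have "\<dots> = ln \<epsilon>" using \<open>\<sigma> > 0\<close> \<epsilon> by (simp add: y_def ln_div)
      finally show ?thesis .
    qed
    then have small: "d * z ^ k \<le> \<epsilon>" using \<open>d > 0\<close> z \<epsilon> by (subst (asm) ln_le_cancel_iff) auto
    obtain C where C: "finite C" "card C \<le> (k\<^sup>2 + k + 1) * N ^ k" "M \<subseteq> (\<Union>c\<in>C. ball c (d * z ^ k))"
      using cov by blast
    note C(3)
    also have "(\<Union>c\<in>C. ball c (d * z ^ k)) \<subseteq> (\<Union>c\<in>C. ball c \<epsilon>)"
      by (intro UN_mono subset_ball small) auto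
    finally have "covering_number \<epsilon> M \<le> enat (card C)" by (rule covering_number_le[OF C(1)])
    with C(2) have "covering_number \<epsilon> M \<le> enat ((k\<^sup>2 + k + 1) * N ^ k)"
      by (meson enat_ord_simps(1) order_trans)
    then obtain n where n: "covering_number \<epsilon> M = enat n" "n \<le> (k\<^sup>2 + k + 1) * N ^ k"
      by (metis enat_ile enat_ord_simps(1))
    have "n \<ge> 1" using covering_number_ge_1[OF \<open>M \<noteq> {}\<close>, of \<epsilon>] n by (simp add: one_enat_def)
    have "ln (real n) \<le> ln (real ((k\<^sup>2 + k + 1) * N ^ k))"
      using of_nat_mono[OF n(2), where 'a = real] \<open>n \<ge> 1\<close> by (intro ln_mono) linarith+
    also have "\<dots> = ln ((real k)\<^sup>2 + real k + 1) + real k * L"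
    proof -
      have "(real k)\<^sup>2 + real k + 1 > 0" by (simp add: add_nonneg_pos)
      moreover have "real ((k\<^sup>2 + k + 1) * N ^ k) = ((real k)\<^sup>2 + real k + 1) * real N ^ k"
        by (simp add: algebra_simps)
      ultimately show ?thesis using \<open>N \<ge> 1\<close> by (simp add: ln_mult_pos ln_realpow L_def)
    qed
    also have "\<dots> \<le> ln ((x \<epsilon>)\<^sup>2 + x \<epsilon> + 1) + x \<epsilon> * L"
    proof (intro add_mono mult_right_mono \<open>L \<ge> 0\<close> kx)
      have "(real k)\<^sup>2 + real k + 1 \<le> (x \<epsilon>)\<^sup>2 + x \<epsilon> + 1"
        using kx by (intro add_mono power_mono) auto
      moreover have "(real k)\<^sup>2 + real k + 1 > 0" by (simp add: add_nonneg_pos)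
      ultimately show "ln ((real k)\<^sup>2 + real k + 1) \<le> ln ((x \<epsilon>)\<^sup>2 + x \<epsilon> + 1)" by simp
    qed
    finally have "ln (real n) / ln (1 / \<epsilon>) \<le> g \<epsilon>"
      unfolding g_def using \<epsilon> by (intro divide_right_mono) auto
    then show ?thesis using n \<epsilon> by simp
  qed
  have "(g \<longlongrightarrow> inverse \<sigma> * L) (at_right 0)"
    unfolding g_def x_def using \<open>\<sigma> > 0\<close> by real_asymp
  then have lim: "(g \<longlongrightarrow> L / \<sigma>) (at_right 0)"
    by (simp only: divide_inverse mult.commute)
  have "fractal_dim M \<le> Limsup (at_right 0) (\<lambda>\<epsilon>. ereal (g \<epsilon>))"
    unfolding fractal_dim_def
  proof (rule Limsup_mono)
    show "\<forall>\<^sub>F \<epsilon> in at_right 0. (case covering_number \<epsilon> M of enat N \<Rightarrow> ereal (ln (real N)) | \<infinity> \<Rightarrow> \<infinity>)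
       / ereal (ln (1 / \<epsilon>)) \<le> ereal (g \<epsilon>)"
      unfolding eventually_at_right_field
      using \<open>d > 0\<close> bound by (intro exI[of _ "min 1 d"]) auto
  qed
  also have "\<dots> = ereal (L / \<sigma>)"
    using lim by (intro lim_imp_Limsup) auto
  finally show ?thesis by (simp add: L_def \<sigma>_def)
qed

section \<open>Exponential attractors\<close>

theorem theorem2p1:
  fixes S :: "nat \<Rightarrow> 'a::banach \<Rightarrow> 'a"
    and B :: "'a set"
    and P :: "'a \<Rightarrow> 'a"
    and \<Lambda> :: nat
    and M\<^sub>1 M\<^sub>2 M\<^sub>3 lam\<^sub>0 lam\<^sub>1 \<alpha> \<zeta> :: real
  assumes semigroup: "discrete_semigroup S"
    and continuous: "\<And>n. continuous_on UNIV (S n)"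
    and bounded_B: "bounded B"
    and absorbing: "\<And>D. bounded D \<Longrightarrow>
          \<exists>T::real. T > 0 \<and> (\<forall>n. real n \<ge> T \<longrightarrow> S n ` D \<subseteq> B)"
    and invariant: "\<And>n. S n ` B \<subseteq> B"
    and P_linear: "linear P"
    and P_projection: "P \<circ> P = P"
    and P_finite_dim: "\<exists>b. finite b \<and> range P = span b"
    and \<Lambda>_eq: "\<Lambda> = dim (range P)"
    and M_pos: "M\<^sub>1 > 0" "M\<^sub>2 > 0" "M\<^sub>3 > 0"
    and P_estimate: "\<And>n \<phi> \<psi>. \<phi> \<in> B \<Longrightarrow> \<psi> \<in> B \<Longrightarrow>
          norm (P (S n \<phi>) - P (S n \<psi>)) \<le> M\<^sub>1 * exp (lam\<^sub>0 * real n) * norm (\<phi> - \<psi>)"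
    and Q_estimate: "\<And>n \<phi> \<psi>. \<phi> \<in> B \<Longrightarrow> \<psi> \<in> B \<Longrightarrow>
          norm ((S n \<phi> - P (S n \<phi>)) - (S n \<psi> - P (S n \<psi>)))
            \<le> (M\<^sub>2 * exp (lam\<^sub>1 * real n) + M\<^sub>3 * exp (lam\<^sub>0 * real n)) * norm (\<phi> - \<psi>)"
    and \<alpha>_pos: "\<alpha> > 0"
    and \<zeta>_eq: "\<zeta> = \<alpha> * exp lam\<^sub>0 + M\<^sub>2 * exp lam\<^sub>1 + M\<^sub>3 * exp lam\<^sub>0"
    and \<zeta>_less: "\<zeta> < 1"
  shows "\<exists>M. exponential_attractor S M \<and>
           fractal_dim M \<le>
             ereal (real \<Lambda> * (ln (real \<Lambda>) + ln (2 + M\<^sub>1 / \<alpha>)) / (- ln \<zeta>)) \<and>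
           ereal (real \<Lambda> * (ln (real \<Lambda>) + ln (2 + M\<^sub>1 / \<alpha>)) / (- ln \<zeta>)) < \<infinity>"
proof -
  define f where "f = S 1"
  have S_pow: "S n = f ^^ n" for n
  proof (induction n)
    case 0
    then show ?case using semigroup by (simp add: discrete_semigroup_def)
  next
    case (Suc n)
    have "S (1 + n) = S 1 \<circ> S n" using semigroup by (simp only: discrete_semigroup_def)
    with Suc show ?case by (simp add: f_def)
  qed
  have "f ` B \<subseteq> B" unfolding f_def by (rule invariant)
  have pow_B: "(f ^^ k) ` B \<subseteq> B" for k using invariant[of k] by (simp add: S_pow)
  have "B \<noteq> {}"
  proof -
    obtain T :: real where T: "\<And>n. real n \<ge> T \<Longrightarrow> S n ` {0} \<subseteq> B"
      using absorbing[of "{0}"] by auto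
    obtain n :: nat where "T \<le> real n" using real_arch_simple by blast
    from T[OF this] show ?thesis by auto
  qed
  obtain d where "d > 0" and d: "\<And>x y. x \<in> B \<Longrightarrow> y \<in> B \<Longrightarrow> norm (x - y) \<le> d"
  proof -
    obtain R where R: "R > 0" "\<And>x. x \<in> B \<Longrightarrow> norm x \<le> R"
      using bounded_B unfolding bounded_pos by blast
    have "norm (x - y) \<le> 2 * R" if "x \<in> B" "y \<in> B" for x y
      using norm_triangle_ineq4[of x y] R(2)[OF that(1)] R(2)[OF that(2)] by linarith
    with R(1) show thesis by (intro that[of "2 * R"]) auto
  qed
  define a where "a = \<alpha> * exp lam\<^sub>0"
  define p where "p = M\<^sub>1 * exp lam\<^sub>0"
  define r where "r = M\<^sub>2 * exp lam\<^sub>1 + M\<^sub>3 * exp lam\<^sub>0"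
  have pos: "a > 0" "p > 0" "r > 0"
    using M_pos \<alpha>_pos by (auto simp: a_def p_def r_def intro: add_pos_pos)
  have \<zeta>: "\<zeta> = a + r" by (simp add: \<zeta>_eq a_def r_def)
  have "\<zeta> > 0" using pos by (simp add: \<zeta>)
  define t where "t = real \<Lambda> * M\<^sub>1 / \<alpha>"
  have "t \<ge> 0" using M_pos \<alpha>_pos by (simp add: t_def)
  define q where "q = nat \<lfloor>t\<rfloor> + 1"
  have q: "t < real q" "real q \<le> t + 1" using \<open>t \<ge> 0\<close> unfolding q_def by linarith+
  have "real (dim (range P)) * p / a = t" by (simp add: t_def p_def a_def \<Lambda>_eq)
  with q have q': "real (dim (range P)) * p / a < real q" by simp
  define N where "N = q ^ \<Lambda>"
  have "N \<ge> 1" by (simp add: N_def q_def)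
  obtain b where b: "finite b" "range P = span b" using P_finite_dim by blast
  have cov: "covered_by_small_sets (N ^ k) (\<zeta> ^ k * d) ((f ^^ k) ` B)" for k
  proof (induction k)
    case 0
    show ?case unfolding covered_by_small_sets_def
      by (rule exI[of _ "{B}"]) (use d in auto)
  next
    case (Suc k)
    have "covered_by_small_sets (N ^ k * q ^ dim (range P)) ((a + r) * (\<zeta> ^ k * d))
            (f ` (f ^^ k) ` B)"
    proof (rule covered_by_small_sets_image[OF b _ pos(2,1) q' _ _ _ Suc.IH])
      show "\<zeta> ^ k * d > 0" using \<open>\<zeta> > 0\<close> \<open>d > 0\<close> by simp
      show "r \<ge> 0" using pos by simp
    next
      fix x y assume "x \<in> (f ^^ k) ` B" "y \<in> (f ^^ k) ` B"
      then have "x \<in> B" "y \<in> B" using pow_B by blast+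
      from P_estimate[OF this, of 1] show "norm (P (f x) - P (f y)) \<le> p * norm (x - y)"
        by (simp add: f_def p_def)
      from Q_estimate[OF \<open>x \<in> B\<close> \<open>y \<in> B\<close>, of 1]
      show "norm ((f x - P (f x)) - (f y - P (f y))) \<le> r * norm (x - y)"
        by (simp add: f_def r_def)
    qed
    then show ?case
      by (simp add: N_def \<Lambda>_eq \<zeta> image_image mult.assoc mult.commute[of "q ^ _"])
  qed
  have lim: "(\<lambda>k. \<zeta> ^ k * d) \<longlonglongrightarrow> 0"
    using \<open>\<zeta> > 0\<close> \<zeta>_less by (intro tendsto_mult_left_zero LIMSEQ_power_zero) auto
  have radius_pos: "\<zeta> ^ k * d > 0" for k using \<open>\<zeta> > 0\<close> \<open>d > 0\<close> by simp
  obtain M where M: "M \<noteq> {}" "compact M" "f ` M \<subseteq> M"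
    and attr: "\<And>k x. x \<in> (f ^^ k) ` B \<Longrightarrow> \<exists>y\<in>M. dist x y \<le> \<zeta> ^ k * d"
    and balls: "\<And>k. \<exists>C. finite C \<and> card C \<le> (k\<^sup>2 + k + 1) * N ^ k \<and>
                   M \<subseteq> (\<Union>c\<in>C. ball c (2 * (\<zeta> ^ k * d)))"
    using dynamical_attractor_from_coverings[OF continuous[of 1, folded f_def] \<open>B \<noteq> {}\<close>
      \<open>f ` B \<subseteq> B\<close> \<open>N \<ge> 1\<close> lim radius_pos covered_by_small_sets_net[OF cov]] by metis
  have "fractal_dim M \<le> ereal (ln (real N) / (- ln \<zeta>))"
  proof (rule fractal_dim_le_of_geometric_coverings[OF M(1) \<open>N \<ge> 1\<close> \<open>\<zeta> > 0\<close> \<zeta>_less])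
    show "2 * d > 0" using \<open>d > 0\<close> by simp
    show "\<exists>C. finite C \<and> card C \<le> (k\<^sup>2 + k + 1) * N ^ k \<and> M \<subseteq> (\<Union>c\<in>C. ball c (2 * d * \<zeta> ^ k))" for k
      using balls[of k] by (simp only: mult_ac)
  qed
  also have "\<dots> \<le> ereal (real \<Lambda> * (ln (real \<Lambda>) + ln (2 + M\<^sub>1 / \<alpha>)) / (- ln \<zeta>))"
  proof -
    have "ln (real N) \<le> real \<Lambda> * (ln (real \<Lambda>) + ln (2 + M\<^sub>1 / \<alpha>))"
    proof (cases "\<Lambda> = 0")
      case True
      then show ?thesis by (simp add: N_def)
    next
      case False
      have "2 + M\<^sub>1 / \<alpha> > 0" using M_pos \<alpha>_pos by (simp add: add_pos_pos)
      have "real q \<le> real \<Lambda> * M\<^sub>1 / \<alpha> + 1" using q by (simp add: t_def)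
      also have "\<dots> \<le> real \<Lambda> * (2 + M\<^sub>1 / \<alpha>)" using False by (simp add: algebra_simps)
      finally have "ln (real q) \<le> ln (real \<Lambda> * (2 + M\<^sub>1 / \<alpha>))"
        by (intro ln_mono) (simp_all add: q_def)
      also have "\<dots> = ln (real \<Lambda>) + ln (2 + M\<^sub>1 / \<alpha>)"
        using False \<open>2 + M\<^sub>1 / \<alpha> > 0\<close> by (intro ln_mult_pos) auto
      finally have "real \<Lambda> * ln (real q) \<le> real \<Lambda> * (ln (real \<Lambda>) + ln (2 + M\<^sub>1 / \<alpha>))"
        by (intro mult_left_mono) auto
      then show ?thesis by (simp add: N_def ln_realpow q_def)
    qed
    then show ?thesis using \<open>\<zeta> > 0\<close> \<zeta>_less by (simp add: divide_right_mono del: divide_minus_right)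
  qed
  finally have dim_le: "fractal_dim M
    \<le> ereal (real \<Lambda> * (ln (real \<Lambda>) + ln (2 + M\<^sub>1 / \<alpha>)) / (- ln \<zeta>))" .
  moreover have "exponential_attractor S M"
    unfolding exponential_attractor_def
  proof (intro conjI allI)
    show "M \<noteq> {}" "compact M" by fact+
    show "S n ` M \<subseteq> M" for n
      unfolding S_pow by (induction n) (use M(3) in auto)
    show "\<bar>fractal_dim M\<bar> \<noteq> \<infinity>"
      using fractal_dim_nonneg[OF M(1)] dim_le by auto
    \<comment> \<open>Half of the decay rate: then \<open>exp \<omega> * \<zeta>\<close> is the square root of \<open>\<zeta>\<close>, still below 1.\<close>
    define \<omega> where "\<omega> = - ln \<zeta> / 2"
    have "\<omega> > 0" using \<open>\<zeta> > 0\<close> \<zeta>_less by (simp add: \<omega>_def)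
    define s where "s = exp \<omega> * \<zeta>"
    have "s = exp (ln \<zeta> / 2)"
      using \<open>\<zeta> > 0\<close> by (simp add: s_def \<omega>_def exp_minus field_simps flip: exp_add)
    then have s: "0 < s" "s < 1" using \<open>\<zeta> > 0\<close> \<zeta>_less by simp_all
    have "(\<lambda>n. ennreal (exp (\<omega> * real n)) * hausdorff_semidist (S n ` D) M) \<longlonglongrightarrow> 0"
      if D: "bounded D" for D
    proof -
      obtain T :: real where T: "\<And>n. real n \<ge> T \<Longrightarrow> S n ` D \<subseteq> B"
        using absorbing[OF D] by auto
      obtain m :: nat where "T \<le> real m" using real_arch_simple by blast
      with T have m: "S m ` D \<subseteq> B" by blast
      define c where "c = exp (\<omega> * real m) * d"
      have "c > 0" using \<open>d > 0\<close> by (simp add: c_def)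
      have dist: "hausdorff_semidist (S (m + k) ` D) M \<le> ennreal (\<zeta> ^ k * d)" for k
        unfolding hausdorff_semidist_def
      proof (rule SUP_least)
        fix x assume "x \<in> S (m + k) ` D"
        then have "x \<in> S (k + m) ` D" by (simp add: add.commute)
        then have "x \<in> (f ^^ k) ` B" using m by (auto simp: S_pow funpow_add)
        from attr[OF this] obtain y where "y \<in> M" "dist x y \<le> \<zeta> ^ k * d" by blast
        then show "(INF y\<in>M. ennreal (norm (x - y))) \<le> ennreal (\<zeta> ^ k * d)"
          by (intro INF_lower2[of y]) (auto simp: dist_norm intro: ennreal_leI)
      qed
      have bound: "ennreal (exp (\<omega> * real (k + m))) * hausdorff_semidist (S (k + m) ` D) M
              \<le> ennreal (c * s ^ k)" for k
      proof -
        have "ennreal (exp (\<omega> * real (k + m))) * hausdorff_semidist (S (k + m) ` D) M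
            \<le> ennreal (exp (\<omega> * real (k + m))) * ennreal (\<zeta> ^ k * d)"
          using dist[of k] by (intro mult_left_mono) (auto simp: add.commute)
        also have "\<dots> = ennreal (exp (\<omega> * real (k + m)) * (\<zeta> ^ k * d))"
          by (simp add: ennreal_mult' less_imp_le radius_pos)
        also have "exp (\<omega> * real (k + m)) * (\<zeta> ^ k * d) = c * s ^ k"
          by (simp add: c_def s_def power_mult_distrib distrib_left exp_add exp_of_nat2_mult)
        finally show ?thesis .
      qed
      have "(\<lambda>k. c * s ^ k) \<longlonglongrightarrow> 0"
        using s by (intro tendsto_mult_right_zero LIMSEQ_power_zero) auto
      then have "(\<lambda>k. ennreal (c * s ^ k)) \<longlonglongrightarrow> 0"
        using tendsto_ennrealI by fastforce
      then have "(\<lambda>k. ennreal (exp (\<omega> * real (k + m))) * hausdorff_semidist (S (k + m) ` D) M)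
          \<longlonglongrightarrow> 0"
        by (rule tendsto_sandwich[OF _ _ tendsto_const, rotated 2]) (use bound in auto)
      then show ?thesis by (rule LIMSEQ_offset)
    qed
    with \<open>\<omega> > 0\<close> show "\<exists>\<omega>>0. \<forall>D. bounded D \<longrightarrow>
        (\<lambda>n. ennreal (exp (\<omega> * real n)) * hausdorff_semidist (S n ` D) M) \<longlonglongrightarrow> 0"
      by blast
  qed
  ultimately show ?thesis by auto
qed
end
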